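(* Let $\varphi\in\mathrm{Diff}^\infty([0,\infty))$ be an expanding diffeomorphism with $\varphi'(0)=\mu>1$, and let $\lambda\in\mathbb{C}$ with $|\lambda|>1$. 1) (Resonant case) If $\lambda=\mu^n$ for some $n\in\mathbb{N}$, then the space $\mathcal{K}$ of smooth solutions on $[0,\infty)$ to $\beta\circ\varphi(x)=\lambda\beta(x)$ is a complex vector space of dimension $1$. Moreover, $\boldsymbol\beta={}^t(\beta_1,\dots,\beta_M)\in C^\infty([0,\infty);\mathbb{C}^M)$ satisfies $\boldsymbol\beta\circ\varphi(x)=A\boldsymbol\beta(x)$ if and only if $\beta_1=\cdots=\beta_{M-1}\equiv0$ and $\beta_M\in\mathcal{K}$. Therefore the space of solutions of this vector equation is also $1$-dimensional. 2) (Non-resonant case) If no positive integer $n\in\mathbb{N}$ satisfies $\lambda=\mu^n$, then there is no smooth solution on $[0,\infty)$ to $\beta\circ\varphi(x)=\lambda\beta(x)$ except $\beta(x)\equiv0$, i.e. $\mathcal{K}=\{0\}$. Likewise, the only smooth solution on $[0,\infty)$ of $\boldsymbol\beta\circ\varphi(x)=A\boldsymbol\beta(x)$ is $\boldsymbol\beta(x)\equiv0$.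
   Context: $\varphi$ expanding means $\varphi(0)=0$ and $\varphi(x)-x>0$ for $x>0$. For $M\ge 2$, $A=(a_{ij})$ is the $M\times M$ Jordan block with eigenvalue $\lambda$: $a_{ij}=\lambda$ for $i=j$, $a_{ij}=1$ for $i=j+1$, and $a_{ij}=0$ otherwise; so the vector equation reads $\beta_1\circ\varphi=\lambda\beta_1$ and $\beta_m\circ\varphi=\lambda\beta_m+\beta_{m-1}$ for $2\le m\le M$. $\mathcal{K}$ is the space of $\beta\in C^\infty([0,\infty);\mathbb{C})$ with $\beta(\varphi(x))=\lambda\beta(x)$ for all $x\ge0$. *)

theory Defs
  imports "HOL-Analysis.Analysis" "HOL-Library.Function_Algebras"
begin

text \<open>Derivatives are taken within the set, so they are one-sided at the endpoint of \<open>{0..}\<close>.\<close>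

primrec nth_deriv_within :: "real set \<Rightarrow> nat \<Rightarrow> (real \<Rightarrow> 'a::real_normed_vector) \<Rightarrow> real \<Rightarrow> 'a" where
  "nth_deriv_within S 0 f = f"
| "nth_deriv_within S (Suc n) f = (\<lambda>x. vector_derivative (nth_deriv_within S n f) (at x within S))"

definition smooth_on :: "real set \<Rightarrow> (real \<Rightarrow> 'a::real_normed_vector) \<Rightarrow> bool" where
  "smooth_on S f \<longleftrightarrow> (\<forall>n. nth_deriv_within S n f differentiable_on S)"

definition halfline_diffeo :: "(real \<Rightarrow> real) \<Rightarrow> bool" where
  "halfline_diffeo \<phi> \<longleftrightarrow>
     bij_betw \<phi> {0..} {0..} \<and> smooth_on {0..} \<phi> \<and> smooth_on {0..} (the_inv_into {0..} \<phi>)"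

definition expanding :: "(real \<Rightarrow> real) \<Rightarrow> bool" where
  "expanding \<phi> \<longleftrightarrow> \<phi> 0 = 0 \<and> (\<forall>x>0. \<phi> x - x > 0)"

text \<open>
  A function on \<open>[0,\<infinity>)\<close> is represented by its extension by \<open>0\<close> to the negative half-line. So
  functions on \<open>[0,\<infinity>)\<close> are equal iff their representatives are, and pointwise addition and
  scaling of representatives are those of the functions. The extension plays no role for smoothness.
\<close>

definition Cinf :: "(real \<Rightarrow> complex) set" where
  "Cinf = {f. smooth_on {0..} f \<and> (\<forall>x<0. f x = 0)}"

text \<open>
  Likewise, a map into \<open>\<complex>\<^sup>M\<close> is given by its components \<open>b 1, \<dots>, b M\<close>, and \<open>b i = 0\<close> for all
  other indices \<open>i\<close>.
\<close>

definition Cinf_vec :: "nat \<Rightarrow> (nat \<Rightarrow> real \<Rightarrow> complex) set" where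
  "Cinf_vec M = {b. (\<forall>i\<in>{1..M}. b i \<in> Cinf) \<and> (\<forall>i. i \<notin> {1..M} \<longrightarrow> b i = 0)}"

definition fun_scale :: "complex \<Rightarrow> (real \<Rightarrow> complex) \<Rightarrow> real \<Rightarrow> complex" where
  "fun_scale c f = (\<lambda>x. c * f x)"

definition vec_fun_scale :: "complex \<Rightarrow> (nat \<Rightarrow> real \<Rightarrow> complex) \<Rightarrow> nat \<Rightarrow> real \<Rightarrow> complex" where
  "vec_fun_scale c b = (\<lambda>i x. c * b i x)"

interpretation fun_space: vector_space fun_scale
  by unfold_locales (auto simp: fun_scale_def fun_eq_iff distrib_left distrib_right)

interpretation vec_fun_space: vector_space vec_fun_scale
  by unfold_locales (auto simp: vec_fun_scale_def fun_eq_iff distrib_left distrib_right)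

definition K_space :: "(real \<Rightarrow> real) \<Rightarrow> complex \<Rightarrow> (real \<Rightarrow> complex) set" where
  "K_space \<phi> lam = {b \<in> Cinf. \<forall>x\<ge>0. b (\<phi> x) = lam * b x}"

definition jordan_entry :: "complex \<Rightarrow> nat \<Rightarrow> nat \<Rightarrow> complex" where
  "jordan_entry lam i j = (if i = j then lam else if i = j + 1 then 1 else 0)"

definition solves_vec_eq :: "(real \<Rightarrow> real) \<Rightarrow> complex \<Rightarrow> nat \<Rightarrow> (nat \<Rightarrow> real \<Rightarrow> complex) \<Rightarrow> bool" where
  "solves_vec_eq \<phi> lam M b \<longleftrightarrow>
     (\<forall>x\<ge>0. \<forall>i\<in>{1..M}. b i (\<phi> x) = (\<Sum>j=1..M. jordan_entry lam i j * b j x))"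

definition vec_solution_space :: "(real \<Rightarrow> real) \<Rightarrow> complex \<Rightarrow> nat \<Rightarrow> (nat \<Rightarrow> real \<Rightarrow> complex) set" where
  "vec_solution_space \<phi> lam M = {b \<in> Cinf_vec M. solves_vec_eq \<phi> lam M b}"

end

theory Submission imports Defs begin

text \<open>
  Everything rests on a smooth linearization (Sternberg's theorem in dimension one): there is a
  smooth \<open>h\<close> on the half-line with \<open>h' > 0\<close>, \<open>h 0 = 0\<close> and \<open>h \<circ> \<phi> = \<mu> h\<close>. With
  \<open>\<psi> = \<phi>\<^sup>-\<^sup>1\<close>, the function \<open>V = h'' / h'\<close> has to satisfy the linear equation
  \<open>V = \<psi>'' / \<psi>' + \<psi>' \<cdot> (V \<circ> \<psi>)\<close>. Its multiplier is \<open>1 / \<mu> < 1\<close> at the fixed point, so a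
  continuous solution is given by a series, and two quadratures recover \<open>h\<close>. The solution is
  smooth because its derivative, if it exists, solves an equation of the same type, whose multiplier
  at \<open>0\<close> is even smaller: \<open>solution_C1\<close> shows that it exists, \<open>solution_Ck\<close> iterates, and
  \<open>smooth_linearization\<close> constructs \<open>h\<close>.

  The operator \<open>D b = b' / h'\<close> is differentiation in the linearizing coordinate. It maps solutions of
  \<open>b \<circ> \<phi> = c b\<close> to solutions of \<open>d \<circ> \<phi> = (c / \<mu>) d\<close>, and lowers the exponent of the powers of
  \<open>h\<close>. After enough applications the factor has modulus below \<open>1\<close>; then the only solution is
  \<open>0\<close>, by looking at the maximum of its modulus on a compact interval. Integrating back, every
  solution is a constant multiple of some \<open>h^n\<close>, and it vanishes unless \<open>c = \<mu>^n\<close>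
  (\<open>eigenfunction_monomial\<close>). Since \<open>h^n\<close> is itself a solution for \<open>c = \<mu>^n\<close>, this settles the scalar
  equation.

  In the Jordan block equation, suppose that the components before \<open>b i\<close> vanish. Then \<open>b i\<close> is
  \<open>e h^n\<close> with \<open>e = 0\<close> or eigenvalue \<open>\<mu>^n\<close>. The next component satisfies
  \<open>g \<circ> \<phi> = \<mu>^n g + e h^n\<close>, and \<open>n\<close> applications of \<open>D\<close> turn this
  into an equation with factor \<open>1\<close> and a constant that is a nonzero multiple of \<open>e\<close>. At the fixed
  point \<open>0\<close> that constant must vanish (\<open>resonance_obstruction\<close>). Hence only the last
  component can be nonzero.
\<close>

section \<open>Differentiability classes on the half-line\<close>

definition halfline_deriv :: "(real \<Rightarrow> 'a::real_normed_vector) \<Rightarrow> (real \<Rightarrow> 'a) \<Rightarrow> bool" where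
  "halfline_deriv f f' \<longleftrightarrow> (\<forall>x\<ge>0. (f has_vector_derivative f' x) (at x within {0..}))"

text \<open>Membership in \<open>C\<^sup>n\<close>, with the derivative quantified rather than computed: any function that
  serves as a derivative may be used, which suits inductions over \<open>n\<close>.\<close>
primrec Ck :: "nat \<Rightarrow> (real \<Rightarrow> 'a::real_normed_vector) \<Rightarrow> bool" where
  "Ck 0 f \<longleftrightarrow> continuous_on {0..} f"
| "Ck (Suc n) f \<longleftrightarrow> (\<exists>f'. halfline_deriv f f' \<and> Ck n f')"

lemma halfline_deriv_cong:
  assumes "halfline_deriv f f'" "\<And>x. x \<ge> 0 \<Longrightarrow> g x = f x" "\<And>x. x \<ge> 0 \<Longrightarrow> g' x = f' x"
  shows "halfline_deriv g g'"
  unfolding halfline_deriv_def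
proof (intro allI impI)
  fix x :: real assume x: "x \<ge> 0"
  have "(f has_vector_derivative g' x) (at x within {0..})"
    using assms x by (simp add: halfline_deriv_def)
  then show "(g has_vector_derivative g' x) (at x within {0..})"
    by (rule has_vector_derivative_transform[rotated 2]) (use assms x in auto)
qed

lemma halfline_deriv_continuous: "halfline_deriv f f' \<Longrightarrow> continuous_on {0..} f"
  unfolding halfline_deriv_def continuous_on_eq_continuous_within
  by (auto intro: has_vector_derivative_continuous)

lemma halfline_deriv_unique:
  assumes "halfline_deriv f f'" "halfline_deriv f g'" "x \<ge> 0"
  shows "f' x = g' x"
proof (rule vector_derivative_unique_within)
  show "at x within {0..} \<noteq> bot"
    using at_le[of "{x<..}" "{0..}" x] trivial_limit_at_right_real[of x] assms(3)
    by (force simp: bot_unique)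
qed (use assms in \<open>auto simp: halfline_deriv_def\<close>)

lemma halfline_deriv_const: "halfline_deriv (\<lambda>x. c) (\<lambda>x. 0)"
  by (simp add: halfline_deriv_def)

lemma halfline_deriv_add:
  "halfline_deriv f f' \<Longrightarrow> halfline_deriv g g' \<Longrightarrow> halfline_deriv (\<lambda>x. f x + g x) (\<lambda>x. f' x + g' x)"
  by (auto simp: halfline_deriv_def intro: has_vector_derivative_add)

lemma halfline_deriv_diff:
  "halfline_deriv f f' \<Longrightarrow> halfline_deriv g g' \<Longrightarrow> halfline_deriv (\<lambda>x. f x - g x) (\<lambda>x. f' x - g' x)"
  by (auto simp: halfline_deriv_def intro: has_vector_derivative_diff)

lemma halfline_deriv_scaleR:
  fixes f :: "real \<Rightarrow> real"
  assumes "halfline_deriv f f'" "halfline_deriv g g'"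
  shows "halfline_deriv (\<lambda>x. f x *\<^sub>R g x) (\<lambda>x. f x *\<^sub>R g' x + f' x *\<^sub>R g x)"
  using assms unfolding halfline_deriv_def
  by (auto intro!: has_vector_derivative_scaleR simp: has_real_derivative_iff_has_vector_derivative)

lemma halfline_deriv_mult_left:
  fixes g :: "real \<Rightarrow> 'a::real_normed_algebra"
  shows "halfline_deriv g g' \<Longrightarrow> halfline_deriv (\<lambda>x. c * g x) (\<lambda>x. c * g' x)"
  by (auto simp: halfline_deriv_def intro: has_vector_derivative_mult_right)

lemma halfline_deriv_compose:
  fixes g :: "real \<Rightarrow> real"
  assumes "halfline_deriv f f'" "halfline_deriv g g'" "\<And>x. x \<ge> 0 \<Longrightarrow> g x \<ge> 0"
  shows "halfline_deriv (\<lambda>x. f (g x)) (\<lambda>x. g' x *\<^sub>R f' (g x))"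
  unfolding halfline_deriv_def
proof (intro allI impI)
  fix x :: real assume x: "x \<ge> 0"
  have g: "(g has_vector_derivative g' x) (at x within {0..})"
    using assms(2) x by (simp add: halfline_deriv_def)
  have "(f has_vector_derivative f' (g x)) (at (g x) within {0..})"
    using assms x by (simp add: halfline_deriv_def)
  then have "(f has_vector_derivative f' (g x)) (at (g x) within g ` {0..})"
    by (rule has_vector_derivative_within_subset) (use assms in auto)
  from vector_diff_chain_within[OF g this]
  show "((\<lambda>x. f (g x)) has_vector_derivative g' x *\<^sub>R f' (g x)) (at x within {0..})"
    by (simp add: o_def)
qed

lemma halfline_deriv_exp:
  fixes f :: "real \<Rightarrow> real"
  assumes "halfline_deriv f f'"
  shows "halfline_deriv (\<lambda>x. exp (f x)) (\<lambda>x. f' x * exp (f x))"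
  using assms unfolding halfline_deriv_def
  by (auto simp flip: has_real_derivative_iff_has_vector_derivative intro!: derivative_eq_intros)

lemma halfline_deriv_zero_const:
  assumes "halfline_deriv f (\<lambda>x. 0)" "x \<ge> 0"
  shows "f x = f 0"
proof -
  obtain c where "\<And>x. x \<in> {0..} \<Longrightarrow> f x = c"
    using has_vector_derivative_zero_constant[of "{0..}" f] assms(1)
    by (auto simp: halfline_deriv_def)
  then show ?thesis using assms(2) by simp
qed

lemma halfline_deriv_eq:
  assumes "halfline_deriv f d" "halfline_deriv g d" "f 0 = g 0" "x \<ge> 0"
  shows "f x = g x"
  using halfline_deriv_zero_const[of "\<lambda>x. f x - g x" x] halfline_deriv_diff[OF assms(1,2)] assms(3,4)
  by simp

lemma halfline_antiderivative:
  fixes f :: "real \<Rightarrow> 'a::banach"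
  assumes "continuous_on {0..} f"
  obtains F where "F 0 = c" "halfline_deriv F f"
proof -
  let ?F = "\<lambda>x. c + integral {0..x} f"
  have "?F 0 = c" by simp
  moreover have "halfline_deriv ?F f"
    unfolding halfline_deriv_def
  proof (intro allI impI)
    fix x :: real assume x: "x \<ge> 0"
    have "((\<lambda>x. integral {0..x} f) has_vector_derivative f x) (at x within {0..x+1})"
      by (rule integral_has_vector_derivative)
        (use x in \<open>auto intro: continuous_on_subset[OF assms]\<close>)
    moreover have "at x within {0..x+1} = at x within {0..}"
      by (rule at_within_nhd[of x "{..<x+1}"]) (use x in auto)
    ultimately show "(?F has_vector_derivative f x) (at x within {0..})"
      by (auto intro!: derivative_eq_intros)
  qed
  ultimately show thesis by (rule that)
qed

lemma Ck_SucD: "Ck (Suc n) f \<Longrightarrow> Ck n f"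
  by (induction n arbitrary: f) (auto intro: halfline_deriv_continuous)

lemma Ck_cong: "Ck n f \<Longrightarrow> (\<And>x. x \<ge> 0 \<Longrightarrow> g x = f x) \<Longrightarrow> Ck n g"
  by (cases n) (auto intro: halfline_deriv_cong continuous_on_eq)

lemma Ck_continuous: "Ck n f \<Longrightarrow> continuous_on {0..} f"
  by (cases n) (auto intro: halfline_deriv_continuous)

lemma Ck_const: "Ck n (\<lambda>x. c)"
  by (induction n arbitrary: c) (auto intro: halfline_deriv_const)

lemma Ck_add: "Ck n f \<Longrightarrow> Ck n g \<Longrightarrow> Ck n (\<lambda>x. f x + g x)"
  by (induction n arbitrary: f g) (auto intro!: continuous_intros, metis halfline_deriv_add)

lemma Ck_mult_left:
  fixes f :: "real \<Rightarrow> 'a::real_normed_algebra"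
  shows "Ck n f \<Longrightarrow> Ck n (\<lambda>x. c * f x)"
  by (induction n arbitrary: f) (auto intro!: continuous_intros, metis halfline_deriv_mult_left)

lemma Ck_scaleR:
  fixes f :: "real \<Rightarrow> real"
  shows "Ck n f \<Longrightarrow> Ck n g \<Longrightarrow> Ck n (\<lambda>x. f x *\<^sub>R g x)"
proof (induction n arbitrary: f g)
  case 0 then show ?case by (auto intro!: continuous_intros)
next
  case (Suc n)
  obtain f' g' where f: "halfline_deriv f f'" "Ck n f'" and g: "halfline_deriv g g'" "Ck n g'"
    using Suc.prems by auto
  show ?case
    using halfline_deriv_scaleR[OF f(1) g(1)]
      Ck_add[OF Suc.IH[OF Ck_SucD[OF Suc.prems(1)] g(2)] Suc.IH[OF f(2) Ck_SucD[OF Suc.prems(2)]]]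
    by auto
qed

lemma Ck_mult:
  fixes f g :: "real \<Rightarrow> real"
  shows "Ck n f \<Longrightarrow> Ck n g \<Longrightarrow> Ck n (\<lambda>x. f x * g x)"
  using Ck_scaleR[of n f g] by simp

lemma Ck_power:
  fixes f :: "real \<Rightarrow> real"
  shows "Ck n f \<Longrightarrow> Ck n (\<lambda>x. f x ^ k)"
  by (induction k) (auto intro: Ck_const Ck_mult)

lemma Ck_compose:
  fixes g :: "real \<Rightarrow> real"
  assumes "\<And>x. x \<ge> 0 \<Longrightarrow> g x \<ge> 0"
  shows "Ck n f \<Longrightarrow> Ck n g \<Longrightarrow> Ck n (\<lambda>x. f (g x))"
proof (induction n arbitrary: f)
  case 0 then show ?case
    using assms by (auto intro!: continuous_on_compose2[of "{0..}" f "{0..}" g])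
next
  case (Suc n)
  obtain f' g' where f: "halfline_deriv f f'" "Ck n f'" and g: "halfline_deriv g g'" "Ck n g'"
    using Suc.prems by auto
  show ?case
    using halfline_deriv_compose[OF f(1) g(1) assms] Suc.IH[OF f(2) Ck_SucD[OF Suc.prems(2)]]
      Ck_scaleR[OF g(2)] by auto
qed

lemma Ck_exp:
  fixes f :: "real \<Rightarrow> real"
  shows "Ck n f \<Longrightarrow> Ck n (\<lambda>x. exp (f x))"
proof (induction n)
  case 0 then show ?case by (auto intro!: continuous_intros)
next
  case (Suc n)
  obtain f' where f: "halfline_deriv f f'" "Ck n f'" using Suc.prems by auto
  show ?case
    using halfline_deriv_exp[OF f(1)] Ck_mult[OF f(2) Suc.IH[OF Ck_SucD[OF Suc.prems]]] by auto
qed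

lemma Ck_all_derivative:
  assumes "\<And>n. Ck n f" "halfline_deriv f f'"
  shows "Ck n f'"
proof -
  obtain g where "halfline_deriv f g" "Ck n g" using assms(1)[of "Suc n"] by auto
  then show ?thesis by (rule_tac Ck_cong) (use halfline_deriv_unique[OF assms(2)] in auto)
qed

text \<open>For smooth functions the derivative chosen by \<open>vector_derivative\<close> is one that serves; this connects
  \<open>Ck\<close> to iterated derivatives.\<close>
lemma Ck_all_vector_derivative:
  assumes "\<And>n. Ck n f"
  shows "halfline_deriv f (\<lambda>x. vector_derivative f (at x within {0..}))"
  unfolding halfline_deriv_def
proof (intro allI impI)
  fix x :: real assume "x \<ge> 0"
  moreover obtain f' where "halfline_deriv f f'" using assms[of "Suc 0"] by auto
  ultimately have "f differentiable (at x within {0..})"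
    unfolding halfline_deriv_def by (blast intro: differentiableI_vector)
  then show "(f has_vector_derivative vector_derivative f (at x within {0..})) (at x within {0..})"
    by (simp add: vector_derivative_works)
qed

lemma smooth_on_halfline_iff: "smooth_on {0..} f \<longleftrightarrow> (\<forall>n. Ck n f)"
proof
  assume f: "smooth_on {0..} f"
  have d: "halfline_deriv (nth_deriv_within {0..} k f) (nth_deriv_within {0..} (Suc k) f)" for k
    using f unfolding smooth_on_def differentiable_on_def halfline_deriv_def
    by (auto simp: vector_derivative_works[symmetric])
  have "Ck n (nth_deriv_within {0..} k f)" for n k
  proof (induction n arbitrary: k)
    case 0 then show ?case using halfline_deriv_continuous[OF d] by simp
  next
    case (Suc n) show ?case using d Suc.IH[of "Suc k"] unfolding Ck.simps(2) by blast
  qed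
  from this[of _ 0] show "\<forall>n. Ck n f" by simp
next
  assume f: "\<forall>n. Ck n f"
  have s: "\<forall>n. Ck n (nth_deriv_within {0..} k f)" for k
  proof (induction k)
    case 0 then show ?case using f by simp
  next
    case (Suc k)
    then have "Ck n (nth_deriv_within {0..} k f)" for n by blast
    from Ck_all_derivative[OF this Ck_all_vector_derivative[OF this]] show ?case by simp
  qed
  show "smooth_on {0..} f"
    unfolding smooth_on_def differentiable_on_def
  proof (intro allI ballI)
    fix n and x :: real assume "x \<in> {0..}"
    then show "nth_deriv_within {0..} n f differentiable at x within {0..}"
      using s[of n] Ck_all_vector_derivative[of "nth_deriv_within {0..} n f"]
      unfolding halfline_deriv_def by (meson atLeast_iff differentiableI_vector)
  qed
qed

lemma Cinf_iff: "b \<in> Cinf \<longleftrightarrow> (\<forall>n. Ck n b) \<and> (\<forall>x<0. b x = 0)"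
  by (simp add: Cinf_def smooth_on_halfline_iff)

section \<open>Linear equations over a contraction of the half-line\<close>

lemma bounded_on_interval:
  fixes f :: "real \<Rightarrow> real"
  assumes "continuous_on {0..} f" "X \<ge> 0"
  obtains B where "\<And>x. 0 \<le> x \<Longrightarrow> x \<le> X \<Longrightarrow> \<bar>f x\<bar> \<le> B"
proof -
  have "\<exists>x\<in>{0..X}. \<forall>y\<in>{0..X}. \<bar>f y\<bar> \<le> \<bar>f x\<bar>"
    by (rule continuous_attains_sup)
      (use assms in \<open>auto intro!: continuous_intros continuous_on_subset[OF assms(1)]\<close>)
  then obtain x where "\<forall>y\<in>{0..X}. \<bar>f y\<bar> \<le> \<bar>f x\<bar>" by blast
  then show thesis using that[of "\<bar>f x\<bar>"] by simp
qed

lemma exponential_growth_bound: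
  fixes E e :: "real \<Rightarrow> real"
  assumes E: "halfline_deriv E e" "E 0 = 0" and L: "L > 0" and C: "C \<ge> 0" and x: "x \<ge> 0"
    and e: "\<And>y. 0 \<le> y \<Longrightarrow> y \<le> x \<Longrightarrow> \<bar>e y\<bar> \<le> C * exp (L * y)"
  shows "\<bar>E x\<bar> \<le> C / L * exp (L * x)"
proof (cases "x = 0")
  case True then show ?thesis using E(2) C L by simp
next
  case False
  define w where "w y = C / L * exp (L * y)" for y
  have "norm (E x - E 0) \<le> w x - w 0"
  proof (rule differentiable_bound_general)
    show "0 < x" using False x by simp
    show "continuous_on {0..x} E"
      by (rule continuous_on_subset[OF halfline_deriv_continuous[OF E(1)]]) auto
    show "continuous_on {0..x} w"
      unfolding w_def by (intro continuous_on_mult continuous_on_exp continuous_on_const continuous_on_id)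
    show "(E has_vector_derivative e y) (at y)" if "0 < y" "y < x" for y
      using E(1) that at_within_interior[of y "{0..}"] unfolding halfline_deriv_def
      by (metis interior_real_atLeast greaterThan_iff less_imp_le)
    show "(w has_vector_derivative C * exp (L * y)) (at y)" for y
      unfolding w_def has_real_derivative_iff_has_vector_derivative[symmetric]
      using L by (auto intro!: derivative_eq_intros)
    show "norm (e y) \<le> C * exp (L * y)" if "0 < y" "y < x" for y using e[of y] that by simp
  qed
  moreover have "0 \<le> C / L" using C L by simp
  ultimately show ?thesis using E(2) unfolding w_def by simp
qed

locale halfline_contraction =
  fixes \<psi> :: "real \<Rightarrow> real"
  assumes cont: "continuous_on {0..} \<psi>" and zero: "\<psi> 0 = 0"
    and pos: "\<And>x. x \<ge> 0 \<Longrightarrow> \<psi> x \<ge> 0" and less: "\<And>x. x > 0 \<Longrightarrow> \<psi> x < x"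
begin

lemma le: "x \<ge> 0 \<Longrightarrow> \<psi> x \<le> x"
  using zero less[of x] by (cases "x = 0") auto

lemma continuous_compose: "continuous_on {0..} f \<Longrightarrow> continuous_on {0..} (\<lambda>x. f (\<psi> x))"
  by (rule continuous_on_compose2[OF _ cont]) (auto intro: pos)

text \<open>The multiplier \<open>a\<close> is smaller than \<open>1\<close> only near the fixed point. The weight \<open>exp (- L x)\<close> makes
  \<open>f \<mapsto> a \<cdot> (f \<circ> \<psi>)\<close> a contraction on all of \<open>[0, X]\<close>: away from \<open>0\<close>, moving from \<open>x\<close> to the smaller
  point \<open>\<psi> x\<close> gains a factor \<open>exp (- L (x - \<psi> x))\<close>, which beats the maximum of \<open>a\<close> for large \<open>L\<close>.
  That \<open>q\<close> does not depend on \<open>L\<close> allows \<open>L\<close> to be increased later.\<close>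
lemma weighted_contraction:
  fixes a :: "real \<Rightarrow> real"
  assumes a: "continuous_on {0..} a" "\<bar>a 0\<bar> < 1" and X: "X \<ge> 0"
  obtains q L0 where "0 < q" "q < 1" "L0 \<ge> 0"
    "\<And>L x. L \<ge> L0 \<Longrightarrow> 0 \<le> x \<Longrightarrow> x \<le> X \<Longrightarrow> \<bar>a x\<bar> * exp (L * \<psi> x) \<le> q * exp (L * x)"
proof -
  define q where "q = (1 + \<bar>a 0\<bar>) / 2"
  have q: "0 < q" "q < 1" "\<bar>a 0\<bar> < q" using a(2) by (auto simp: q_def)
  have "((\<lambda>x. \<bar>a x\<bar>) \<longlongrightarrow> \<bar>a 0\<bar>) (at 0 within {0..})"
    using a(1) by (auto simp: continuous_on_def intro!: tendsto_intros)
  then have "eventually (\<lambda>x. \<bar>a x\<bar> < q) (at 0 within {0..})"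
    using q(3) by (rule order_tendstoD)
  then obtain \<delta> where \<delta>: "\<delta> > 0" "\<And>x. 0 < x \<Longrightarrow> x < \<delta> \<Longrightarrow> \<bar>a x\<bar> < q"
    unfolding eventually_at by (auto simp: dist_real_def)
  have near: "\<bar>a x\<bar> \<le> q" if "0 \<le> x" "x < \<delta>" for x
    using \<delta>(2)[of x] that q(3) by (cases "x = 0") auto
  obtain A where A: "\<And>x. 0 \<le> x \<Longrightarrow> x \<le> X \<Longrightarrow> \<bar>a x\<bar> \<le> A"
    by (rule bounded_on_interval[OF a(1) X]) blast
  have A0: "A \<ge> 0" using A[of 0] X by auto
  obtain c where c: "c > 0" "\<And>x. \<delta> \<le> x \<Longrightarrow> x \<le> X \<Longrightarrow> x - \<psi> x \<ge> c"
  proof (cases "\<delta> \<le> X")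
    case True
    have "\<exists>x\<in>{\<delta>..X}. \<forall>y\<in>{\<delta>..X}. x - \<psi> x \<le> y - \<psi> y"
      by (rule continuous_attains_inf)
        (use True \<delta>(1) in \<open>auto intro!: continuous_intros continuous_on_subset[OF cont]\<close>)
    then obtain x where "x \<in> {\<delta>..X}" "\<forall>y\<in>{\<delta>..X}. x - \<psi> x \<le> y - \<psi> y" by blast
    then show ?thesis using that[of "x - \<psi> x"] less[of x] \<delta>(1) by auto
  next
    case False
    then show ?thesis using that[of 1] by auto
  qed
  let ?L0 = "A / (q * c)"
  have "\<bar>a x\<bar> * exp (L * \<psi> x) \<le> q * exp (L * x)" if L: "L \<ge> ?L0" and x: "0 \<le> x" "x \<le> X" for L x
  proof -
    have L0: "L \<ge> 0" using L A0 q c(1) by (smt (verit) divide_nonneg_pos mult_pos_pos)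
    show ?thesis
    proof (cases "x < \<delta>")
      case True
      then show ?thesis
        using near[OF x(1)] le[OF x(1)] L0 q by (intro mult_mono) (auto intro: mult_left_mono)
    next
      case False
      \<comment> \<open>away from the fixed point the displacement is at least \<open>c\<close>, so the weight absorbs the bound \<open>A\<close> of \<open>a\<close>\<close>
      have d: "c \<le> x - \<psi> x" using False x by (intro c) auto
      have "A \<le> q * (L * c)" using L q c(1) by (simp add: field_simps)
      also have "\<dots> \<le> q * (L * (x - \<psi> x))" using d L0 q by (intro mult_left_mono) auto
      also have "\<dots> \<le> q * exp (L * (x - \<psi> x))"
        using exp_ge_add_one_self[of "L * (x - \<psi> x)"] q(1)
        by (intro mult_left_mono) linarith+
      finally have "\<bar>a x\<bar> \<le> q * exp (L * (x - \<psi> x))" using A[OF x] by simp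
      then have "\<bar>a x\<bar> * exp (L * \<psi> x) \<le> q * exp (L * (x - \<psi> x)) * exp (L * \<psi> x)"
        by (rule mult_right_mono) simp
      then show ?thesis by (simp add: exp_add[symmetric] algebra_simps)
    qed
  qed
  moreover have "0 \<le> ?L0" using q A0 c(1) by simp
  ultimately show thesis using that[OF q(1,2)] by blast
qed

text \<open>The solution is the Neumann series of the iterates \<open>t n\<close> of \<open>f \<mapsto> a \<cdot> (f \<circ> \<psi>)\<close> on \<open>u\<close>, which
  converges geometrically and uniformly on each \<open>[0, X]\<close> by the weighted estimate.\<close>
lemma continuous_solution:
  fixes a u :: "real \<Rightarrow> real"
  assumes a: "continuous_on {0..} a" "\<bar>a 0\<bar> < 1" and u: "continuous_on {0..} u"
  obtains V where "continuous_on {0..} V" "\<And>x. x \<ge> 0 \<Longrightarrow> V x = u x + a x * V (\<psi> x)"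
proof -
  define t where "t = rec_nat u (\<lambda>n f x. a x * f (\<psi> x))"
  have t0: "t 0 = u" and tSuc: "t (Suc n) = (\<lambda>x. a x * t n (\<psi> x))" for n
    by (auto simp: t_def)
  have tc: "continuous_on {0..} (t n)" for n
    by (induction n) (auto simp: t0 tSuc intro!: continuous_intros continuous_compose a u)
  define V where "V x = (\<Sum>n. t n x)" for x
  have *: "continuous_on {0..X} V \<and> (\<forall>x\<in>{0..X}. summable (\<lambda>n. t n x))" if X: "X \<ge> 0" for X
  proof -
    obtain q L where q: "0 < q" "q < 1" "L \<ge> 0"
      and qL: "\<And>L' x. L' \<ge> L \<Longrightarrow> 0 \<le> x \<Longrightarrow> x \<le> X \<Longrightarrow> \<bar>a x\<bar> * exp (L' * \<psi> x) \<le> q * exp (L' * x)"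
      by (rule weighted_contraction[OF a X]) (rule that)
    obtain B where B: "\<And>x. 0 \<le> x \<Longrightarrow> x \<le> X \<Longrightarrow> \<bar>u x\<bar> \<le> B"
      by (rule bounded_on_interval[OF u X]) blast
    have B0: "B \<ge> 0" using B[of 0] X by auto
    have bound: "\<bar>t n x\<bar> \<le> B * q ^ n * exp (L * x)" if "0 \<le> x" "x \<le> X" for n x
      using that
    proof (induction n arbitrary: x)
      case 0
      have "B * 1 \<le> B * exp (L * x)" using 0 q(3) B0 by (intro mult_left_mono) auto
      then show ?case using B[OF 0] by (simp add: t0)
    next
      case (Suc n)
      have "\<bar>t (Suc n) x\<bar> \<le> \<bar>a x\<bar> * (B * q ^ n * exp (L * \<psi> x))"
        unfolding tSuc abs_mult
        using Suc.IH[of "\<psi> x"] pos[of x] le[of x] Suc.prems by (intro mult_left_mono) auto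
      also have "\<dots> = B * q ^ n * (\<bar>a x\<bar> * exp (L * \<psi> x))" by simp
      also have "\<dots> \<le> B * q ^ n * (q * exp (L * x))"
        using qL[OF order_refl Suc.prems] q(1) B0 by (intro mult_left_mono) auto
      finally show ?case by (simp add: mult_ac)
    qed
    have bound': "norm (t n x) \<le> B * q ^ n * exp (L * X)" if "x \<in> {0..X}" for n x
    proof -
      have "B * q ^ n * exp (L * x) \<le> B * q ^ n * exp (L * X)"
        using that q B0 by (intro mult_left_mono) (auto intro: mult_left_mono)
      with bound[of x n] that show ?thesis by auto
    qed
    have sm: "summable (\<lambda>n. B * q ^ n * exp (L * X))"
      using q by (intro summable_mult summable_mult2 summable_geometric) auto
    have "uniform_limit {0..X} (\<lambda>n x. \<Sum>i<n. t i x) V sequentially"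
      unfolding V_def by (rule Weierstrass_m_test[OF bound' sm])
    then have "continuous_on {0..X} V"
      by (rule uniform_limit_theorem[rotated])
        (auto intro!: always_eventually continuous_intros continuous_on_subset[OF tc])
    moreover have "\<forall>x\<in>{0..X}. summable (\<lambda>n. t n x)"
      by (intro ballI summable_comparison_test'[OF sm, of 0]) (rule bound')
    ultimately show ?thesis by blast
  qed
  have "continuous (at x within {0..}) V" if "x \<ge> 0" for x
  proof -
    have "continuous (at x within {0..x+1}) V"
      using *[of "x + 1"] that by (auto simp: continuous_on_eq_continuous_within)
    moreover have "at x within {0..x+1} = at x within {0..}"
      by (rule at_within_nhd[of x "{..<x+1}"]) (use that in auto)
    ultimately show ?thesis by simp
  qed
  then have Vc: "continuous_on {0..} V" by (auto simp: continuous_on_eq_continuous_within)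
  have "V x = u x + a x * V (\<psi> x)" if x: "x \<ge> 0" for x
  proof -
    have s: "summable (\<lambda>n. t n x)" "summable (\<lambda>n. t n (\<psi> x))"
      using *[of x] x pos[of x] le[of x] by auto
    have "V x = u x + (\<Sum>n. t (Suc n) x)"
      using suminf_split_head[OF s(1)] by (simp add: V_def t0)
    also have "\<dots> = u x + a x * V (\<psi> x)"
      using suminf_mult[OF s(2), of "a x"] by (simp add: V_def tSuc)
    finally show ?thesis .
  qed
  with Vc show thesis by (rule that)
qed

text \<open>A Gronwall argument in the weighted norm \<open>m = max \<bar>D x\<bar> exp (- L x)\<close>: the first term contributes
  at most \<open>q m\<close>, and integration against \<open>exp (L x)\<close> gains \<open>1 / L\<close>, so \<open>E\<close> contributes at most
  \<open>(B / L) m\<close>. For large \<open>L\<close> this forces \<open>m = 0\<close>.\<close>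
lemma homogeneous_solution_zero:
  fixes a b D E :: "real \<Rightarrow> real"
  assumes a: "continuous_on {0..} a" "\<bar>a 0\<bar> < 1" and b: "continuous_on {0..} b"
    and D: "continuous_on {0..} D"
    and E: "halfline_deriv E (\<lambda>x. b x * D (\<psi> x))" "E 0 = 0"
    and eq: "\<And>x. x \<ge> 0 \<Longrightarrow> D x = a x * D (\<psi> x) - E x"
    and X: "X \<ge> 0"
  shows "D X = 0"
proof -
  obtain q L0 where q: "0 < q" "q < 1" "L0 \<ge> 0"
    "\<And>L x. L \<ge> L0 \<Longrightarrow> 0 \<le> x \<Longrightarrow> x \<le> X \<Longrightarrow> \<bar>a x\<bar> * exp (L * \<psi> x) \<le> q * exp (L * x)"
    by (rule weighted_contraction[OF a X]) (rule that)
  obtain B where B: "\<And>x. 0 \<le> x \<Longrightarrow> x \<le> X \<Longrightarrow> \<bar>b x\<bar> \<le> B"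
    by (rule bounded_on_interval[OF b X]) blast
  have B0: "B \<ge> 0" using B[of 0] X by auto
  \<comment> \<open>chosen so that \<open>q + B / L < 1\<close>\<close>
  define L where "L = L0 + (B + 1) / (1 - q)"
  have L: "L \<ge> L0" "L > 0" "B / L < 1 - q"
  proof -
    have p: "(B + 1) / (1 - q) > 0" using B0 q(1,2) by auto
    then show L1: "L \<ge> L0" "L > 0" using q(1-3) by (auto simp: L_def)
    have "(B + 1) / (1 - q) \<le> L" using q(1-3) by (simp add: L_def)
    then have "B + 1 \<le> L * (1 - q)" using q(1-3) by (simp add: field_simps)
    then show "B / L < 1 - q" using L1 by (simp add: field_simps)
  qed
  have "\<exists>x\<in>{0..X}. \<forall>y\<in>{0..X}. \<bar>D y\<bar> * exp (- L * y) \<le> \<bar>D x\<bar> * exp (- L * x)"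
    by (rule continuous_attains_sup)
      (use X in \<open>auto intro!: continuous_intros continuous_on_subset[OF D]\<close>)
  then obtain x where x: "0 \<le> x" "x \<le> X"
    and max: "\<And>y. 0 \<le> y \<Longrightarrow> y \<le> X \<Longrightarrow> \<bar>D y\<bar> * exp (- L * y) \<le> \<bar>D x\<bar> * exp (- L * x)"
    by auto
  define m where "m = \<bar>D x\<bar> * exp (- L * x)"
  have m0: "m \<ge> 0" by (simp add: m_def)
  have Dm: "\<bar>D y\<bar> \<le> m * exp (L * y)" if "0 \<le> y" "y \<le> X" for y
    using mult_right_mono[OF max[OF that], of "exp (L * y)"]
    by (simp add: m_def mult.assoc flip: exp_add)
  have Ex: "\<bar>E x\<bar> \<le> B * m / L * exp (L * x)"
  proof (rule exponential_growth_bound[OF E L(2) _ x(1)])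
    show "0 \<le> B * m" using B0 m0 by simp
    fix y assume y: "0 \<le> y" "y \<le> x"
    have "\<bar>D (\<psi> y)\<bar> \<le> m * exp (L * \<psi> y)" using y x le[of y] pos[of y] by (intro Dm) auto
    also have "\<dots> \<le> m * exp (L * y)" using y le[of y] L m0 by (intro mult_left_mono) auto
    finally have "\<bar>b y\<bar> * \<bar>D (\<psi> y)\<bar> \<le> B * (m * exp (L * y))"
      using B[of y] y x B0 by (intro mult_mono) auto
    then show "\<bar>b y * D (\<psi> y)\<bar> \<le> B * m * exp (L * y)" by (simp add: abs_mult mult_ac)
  qed
  have "\<bar>a x * D (\<psi> x)\<bar> \<le> \<bar>a x\<bar> * (m * exp (L * \<psi> x))"
    unfolding abs_mult using x le[of x] pos[of x] by (intro mult_left_mono Dm) auto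
  also have "\<dots> \<le> m * (q * exp (L * x))"
    using mult_left_mono[OF q(4)[OF L(1) x] m0] by (simp add: mult_ac)
  finally have "\<bar>D x\<bar> \<le> m * (q * exp (L * x)) + B * m / L * exp (L * x)"
    using eq[OF x(1)] Ex by linarith
  also have "\<dots> = m * (q + B / L) * exp (L * x)" by (simp add: algebra_simps)
  finally have "\<bar>D x\<bar> * exp (- L * x) \<le> m * (q + B / L) * exp (L * x) * exp (- L * x)"
    by (rule mult_right_mono) simp
  also have "\<dots> = m * (q + B / L)" by (simp add: mult.assoc flip: exp_add)
  finally have "m \<le> m * (q + B / L)" unfolding m_def .
  then have "m * (1 - (q + B / L)) \<le> 0" by (simp add: algebra_simps)
  moreover have "0 < 1 - (q + B / L)" using L(3) by simp
  ultimately have "m = 0" using m0 by (metis mult_le_0_iff not_less order_antisym)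
  then show ?thesis using Dm[of X] X by simp
qed

text \<open>Formal differentiation of \<open>V = u + a \<cdot> (V \<circ> \<psi>)\<close> gives a linear equation for the derivative with
  multiplier \<open>a \<psi>'\<close>. Let \<open>W\<close> be its continuous solution and \<open>I\<close> the antiderivative of \<open>W\<close> that
  agrees with \<open>V\<close> at \<open>0\<close>. The defect \<open>D = V - I\<close> solves a homogeneous equation and thus vanishes, so
  \<open>W\<close> is the derivative of \<open>V\<close>.\<close>
lemma solution_C1:
  fixes a u V :: "real \<Rightarrow> real"
  assumes \<psi>: "halfline_deriv \<psi> \<psi>'" "continuous_on {0..} \<psi>'" "\<bar>\<psi>' 0\<bar> \<le> 1"
    and a: "halfline_deriv a a'" "continuous_on {0..} a'" "\<bar>a 0\<bar> < 1"
    and u: "halfline_deriv u u'" "continuous_on {0..} u'"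
    and V: "continuous_on {0..} V" "\<And>x. x \<ge> 0 \<Longrightarrow> V x = u x + a x * V (\<psi> x)"
  obtains W where "halfline_deriv V W" "continuous_on {0..} W"
    "\<And>x. x \<ge> 0 \<Longrightarrow> W x = (u' x + a' x * V (\<psi> x)) + (a x * \<psi>' x) * W (\<psi> x)"
proof -
  have ac: "continuous_on {0..} a" by (rule halfline_deriv_continuous[OF a(1)])
  have 1: "\<bar>a 0 * \<psi>' 0\<bar> < 1"
    using mult_mono[of "\<bar>a 0\<bar>" "\<bar>a 0\<bar>" "\<bar>\<psi>' 0\<bar>" 1] \<psi>(3) a(3) by (simp add: abs_mult)
  have 2: "continuous_on {0..} (\<lambda>x. a x * \<psi>' x)"
    by (intro continuous_intros ac \<psi>(2))
  have 3: "continuous_on {0..} (\<lambda>x. u' x + a' x * V (\<psi> x))"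
    by (intro continuous_intros u(2) a(2) continuous_compose V(1))
  obtain W where W: "continuous_on {0..} W"
    "\<And>x. x \<ge> 0 \<Longrightarrow> W x = (u' x + a' x * V (\<psi> x)) + (a x * \<psi>' x) * W (\<psi> x)"
    by (rule continuous_solution[OF 2 1 3]) (rule that)
  obtain I where I: "I 0 = V 0" "halfline_deriv I W"
    using halfline_antiderivative[OF W(1)] by metis
  define D where "D x = V x - I x" for x
  define E where "E x = I x - (u x + a x * I (\<psi> x))" for x
  have "halfline_deriv E (\<lambda>x. W x - (u' x + (a x * (\<psi>' x * W (\<psi> x)) + a' x * I (\<psi> x))))"
    unfolding E_def
    using halfline_deriv_diff[OF I(2) halfline_deriv_add[OF u(1)
          halfline_deriv_scaleR[OF a(1) halfline_deriv_compose[OF I(2) \<psi>(1) pos]]]] by simp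
  then have E: "halfline_deriv E (\<lambda>x. a' x * D (\<psi> x))"
    by (rule halfline_deriv_cong) (auto simp: W(2) D_def algebra_simps)
  have "D x = 0" if "x \<ge> 0" for x
  proof (rule homogeneous_solution_zero[OF ac a(3) a(2) _ E _ _ that])
    show "continuous_on {0..} D"
      unfolding D_def by (intro continuous_intros V(1) halfline_deriv_continuous[OF I(2)])
    show "E 0 = 0" using V(2)[of 0] I(1) by (simp add: E_def zero)
    show "D x = a x * D (\<psi> x) - E x" if "x \<ge> 0" for x
      using V(2)[OF that] by (simp add: D_def E_def algebra_simps)
  qed
  then have "halfline_deriv V W"
    by (intro halfline_deriv_cong[OF I(2)]) (auto simp: D_def)
  then show thesis using W by (rule that)
qed

text \<open>Bootstrapping: if \<open>V\<close> is \<open>C\<^sup>m\<close>, so is the right-hand side \<open>u' + a' \<cdot> (V \<circ> \<psi>)\<close> of the equation for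
  its derivative. The induction hypothesis applies to that equation too, because \<open>a\<close> and \<open>u\<close> are
  arbitrary in it.\<close>
lemma solution_Ck:
  fixes a u V :: "real \<Rightarrow> real"
  assumes \<psi>: "\<And>n. Ck n \<psi>" "halfline_deriv \<psi> \<psi>'" "\<bar>\<psi>' 0\<bar> \<le> 1"
  shows "\<forall>n. Ck n a \<Longrightarrow> \<bar>a 0\<bar> < 1 \<Longrightarrow> Ck m u \<Longrightarrow> continuous_on {0..} V \<Longrightarrow>
    \<forall>x\<ge>0. V x = u x + a x * V (\<psi> x) \<Longrightarrow> Ck m V"
proof (induction m arbitrary: a u V)
  case 0 then show ?case by simp
next
  case (Suc m)
  have as: "Ck n a" for n using Suc.prems(1) by blast
  have eq: "V x = u x + a x * V (\<psi> x)" if "x \<ge> 0" for x using Suc.prems(5) that by blast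
  have \<psi>': "Ck n \<psi>'" for n by (rule Ck_all_derivative[OF \<psi>(1,2)])
  obtain a' where a': "halfline_deriv a a'" using as[of "Suc 0"] by auto
  have a'': "Ck n a'" for n by (rule Ck_all_derivative[OF as a'])
  obtain u' where u': "halfline_deriv u u'" "Ck m u'" using Suc.prems(3) by auto
  obtain W where W: "halfline_deriv V W" "continuous_on {0..} W"
    and W_eq: "\<forall>x\<ge>0. W x = (u' x + a' x * V (\<psi> x)) + (a x * \<psi>' x) * W (\<psi> x)"
    using solution_C1[OF \<psi>(2) Ck_continuous[OF \<psi>'] \<psi>(3) a' Ck_continuous[OF a''] Suc.prems(2)
        u'(1) Ck_continuous[OF u'(2)] Suc.prems(4) eq] by metis
  have V: "Ck m V" by (rule Suc.IH[OF Suc.prems(1,2) Ck_SucD[OF Suc.prems(3)] Suc.prems(4,5)])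
  show ?case
  proof (simp, intro exI conjI)
    show "halfline_deriv V W" by (rule W(1))
    show "Ck m W"
    proof (rule Suc.IH[OF _ _ _ W(2) W_eq])
      show "\<forall>n. Ck n (\<lambda>x. a x * \<psi>' x)" by (intro allI Ck_mult as \<psi>')
      show "\<bar>a 0 * \<psi>' 0\<bar> < 1"
        using mult_mono[of "\<bar>a 0\<bar>" "\<bar>a 0\<bar>" "\<bar>\<psi>' 0\<bar>" 1] \<psi>(3) Suc.prems(2) by (simp add: abs_mult)
      show "Ck m (\<lambda>x. u' x + a' x * V (\<psi> x))"
        using Ck_add[OF u'(2) Ck_mult[OF a'' Ck_compose[OF pos V \<psi>(1)]]] by simp
    qed
  qed
qed

end

section \<open>Linearization of the expansion\<close>

text \<open>The exponent \<open>G\<close> of \<open>h' = H = exp G\<close> is an antiderivative of the solution \<open>V\<close> of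
  \<open>V = u + \<psi>' \<cdot> (V \<circ> \<psi>)\<close> for \<open>u = \<psi>'' / \<psi>'\<close>, written without division as
  \<open>(\<phi>' \<circ> \<psi>) \<psi>''\<close>. This equation says exactly that \<open>(H \<circ> \<psi>) \<psi>' / H\<close> has derivative \<open>0\<close>; its
  value at \<open>0\<close> is \<open>1 / \<mu>\<close>. So \<open>h \<circ> \<psi>\<close> and \<open>h / \<mu>\<close> have the same derivative and the same value at \<open>0\<close>.\<close>
lemma smooth_linearization:
  assumes \<phi>: "halfline_diffeo \<phi>" "expanding \<phi>"
    and \<mu>: "(\<phi> has_real_derivative \<mu>) (at 0 within {0..})" "\<mu> > 1"
  obtains h H where "halfline_deriv h H" "\<And>n. Ck n h" "\<And>n. Ck n (\<lambda>x. inverse (H x))"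
    "\<And>x. H x > 0" "h 0 = 0" "\<And>x. x \<ge> 0 \<Longrightarrow> h (\<phi> x) = \<mu> * h x"
proof -
  define \<psi> where "\<psi> = the_inv_into {0..} \<phi>"
  have bij: "bij_betw \<phi> {0..} {0..}" and \<phi>s: "Ck n \<phi>" and \<psi>s: "Ck n \<psi>" for n
    using \<phi>(1) by (auto simp: halfline_diffeo_def smooth_on_halfline_iff \<psi>_def)
  have \<phi>0: "\<phi> 0 = 0" and \<phi>gt: "\<And>x. x > 0 \<Longrightarrow> \<phi> x > x"
    using \<phi>(2) by (auto simp: expanding_def)
  have \<phi>pos: "\<phi> x \<ge> 0" if "x \<ge> 0" for x using bij that by (auto simp: bij_betw_def)
  have \<psi>\<phi>: "\<psi> (\<phi> x) = x" if "x \<ge> 0" for x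
    using bij that by (auto simp: bij_betw_def \<psi>_def intro: the_inv_into_f_f)
  have \<phi>\<psi>: "\<phi> (\<psi> x) = x" if "x \<ge> 0" for x
    using bij that unfolding \<psi>_def by (intro f_the_inv_into_f_bij_betw) auto
  have \<psi>pos: "\<psi> x \<ge> 0" if "x \<ge> 0" for x
    using bij_betw_the_inv_into[OF bij] that by (auto simp: bij_betw_def \<psi>_def)
  have \<psi>0: "\<psi> 0 = 0" using \<psi>\<phi>[of 0] \<phi>0 by simp
  have \<psi>lt: "\<psi> x < x" if "x > 0" for x
    using \<phi>gt[of "\<psi> x"] \<phi>\<psi>[of x] \<psi>pos[of x] that by (cases "\<psi> x = 0") auto
  interpret halfline_contraction \<psi>
    using Ck_continuous[OF \<psi>s] \<psi>0 \<psi>pos \<psi>lt by unfold_locales auto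
  obtain \<phi>' where \<phi>': "halfline_deriv \<phi> \<phi>'" using \<phi>s[of "Suc 0"] by auto
  obtain \<psi>' where \<psi>': "halfline_deriv \<psi> \<psi>'" using \<psi>s[of "Suc 0"] by auto
  have \<phi>'s: "Ck n \<phi>'" for n by (rule Ck_all_derivative[OF \<phi>s \<phi>'])
  have \<psi>'s: "Ck n \<psi>'" for n by (rule Ck_all_derivative[OF \<psi>s \<psi>'])
  obtain \<psi>'' where \<psi>'': "halfline_deriv \<psi>' \<psi>''" using \<psi>'s[of "Suc 0"] by auto
  have \<psi>''s: "Ck n \<psi>''" for n by (rule Ck_all_derivative[OF \<psi>'s \<psi>''])
  have inv: "\<psi>' x * \<phi>' (\<psi> x) = 1" if "x \<ge> 0" for x
  proof -
    have 1: "halfline_deriv (\<lambda>x. \<phi> (\<psi> x)) (\<lambda>x. \<psi>' x * \<phi>' (\<psi> x))"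
      using halfline_deriv_compose[OF \<phi>' \<psi>' \<psi>pos] by simp
    have "halfline_deriv (\<lambda>x. x) (\<lambda>x. 1)" by (simp add: halfline_deriv_def)
    then have 2: "halfline_deriv (\<lambda>x. \<phi> (\<psi> x)) (\<lambda>x. 1)"
      by (rule halfline_deriv_cong) (auto simp: \<phi>\<psi>)
    show ?thesis by (rule halfline_deriv_unique[OF 1 2 that])
  qed
  have "\<phi>' 0 = \<mu>"
  proof (rule vector_derivative_unique_within)
    show "at (0::real) within {0..} \<noteq> bot"
      using trivial_limit_at_right_real[of "0::real"] at_le[of "{0<..}" "{0..}" "0::real"]
      by (force simp: bot_unique)
  qed (use \<phi>' \<mu>(1) in \<open>auto simp: halfline_deriv_def has_real_derivative_iff_has_vector_derivative\<close>)
  then have \<psi>'0: "\<psi>' 0 = 1 / \<mu>" using inv[of 0] \<psi>0 \<mu>(2) by (simp add: field_simps)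
  have \<psi>'lt: "\<bar>\<psi>' 0\<bar> < 1" using \<mu>(2) by (simp add: \<psi>'0)
  have us: "Ck n (\<lambda>x. \<phi>' (\<psi> x) * \<psi>'' x)" for n
    by (rule Ck_mult[OF Ck_compose[OF \<psi>pos \<phi>'s \<psi>s] \<psi>''s])
  obtain V where V: "continuous_on {0..} V"
    "\<And>x. x \<ge> 0 \<Longrightarrow> V x = \<phi>' (\<psi> x) * \<psi>'' x + \<psi>' x * V (\<psi> x)"
    by (rule continuous_solution[OF Ck_continuous[OF \<psi>'s] \<psi>'lt Ck_continuous[OF us]]) (rule that)
  have Vs: "Ck n V" for n
    using solution_Ck[OF \<psi>s \<psi>' less_imp_le[OF \<psi>'lt], of \<psi>' n "\<lambda>x. \<phi>' (\<psi> x) * \<psi>'' x" V]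
      \<psi>'s \<psi>'lt us V by blast
  obtain G where G: "G 0 = 0" "halfline_deriv G V"
    using halfline_antiderivative[OF V(1)] by metis
  have Gs: "Ck n G" for n using Ck_SucD[of n G] G(2) Vs[of n] by auto
  define H where "H x = exp (G x)" for x
  have Hs: "Ck n H" for n unfolding H_def by (rule Ck_exp[OF Gs])
  obtain h where h: "h 0 = 0" "halfline_deriv h H"
    using halfline_antiderivative[OF Ck_continuous[OF Hs]] by metis
  have G\<psi>: "halfline_deriv (\<lambda>x. G (\<psi> x)) (\<lambda>x. \<psi>' x * V (\<psi> x))"
    using halfline_deriv_compose[OF G(2) \<psi>' \<psi>pos] by simp
  have "halfline_deriv (\<lambda>x. exp (G (\<psi> x) - G x) * \<psi>' x)
      (\<lambda>x. exp (G (\<psi> x) - G x) * \<psi>'' x + (\<psi>' x * V (\<psi> x) - V x) * exp (G (\<psi> x) - G x) * \<psi>' x)"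
    using halfline_deriv_scaleR[OF halfline_deriv_exp[OF halfline_deriv_diff[OF G\<psi> G(2)]] \<psi>''] by simp
  then have const: "halfline_deriv (\<lambda>x. exp (G (\<psi> x) - G x) * \<psi>' x) (\<lambda>x. 0)"
  proof (rule halfline_deriv_cong)
    fix x :: real assume x: "x \<ge> 0"
    have e: "\<psi>' x * V (\<psi> x) - V x = - (\<phi>' (\<psi> x) * \<psi>'' x)"
      using V(2)[OF x] by simp
    have "exp (G (\<psi> x) - G x) * \<psi>'' x + (\<psi>' x * V (\<psi> x) - V x) * exp (G (\<psi> x) - G x) * \<psi>' x
      = exp (G (\<psi> x) - G x) * \<psi>'' x * (1 - \<psi>' x * \<phi>' (\<psi> x))"
      unfolding e by (simp add: algebra_simps)
    then show "0 = exp (G (\<psi> x) - G x) * \<psi>'' x + (\<psi>' x * V (\<psi> x) - V x) * exp (G (\<psi> x) - G x) * \<psi>' x"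
      using inv[OF x] by simp
  qed simp
  have H\<psi>: "\<psi>' x * H (\<psi> x) = 1 / \<mu> * H x" if "x \<ge> 0" for x
    using halfline_deriv_zero_const[OF const that] \<psi>'0 \<psi>0
    by (simp add: H_def exp_diff field_simps)
  have h\<psi>: "h (\<psi> x) = 1 / \<mu> * h x" if "x \<ge> 0" for x
  proof (rule halfline_deriv_eq[OF _ halfline_deriv_mult_left[OF h(2)] _ that])
    show "halfline_deriv (\<lambda>x. h (\<psi> x)) (\<lambda>x. 1 / \<mu> * H x)"
      by (rule halfline_deriv_cong[OF halfline_deriv_compose[OF h(2) \<psi>' \<psi>pos]]) (auto simp: H\<psi>)
  qed (simp add: \<psi>0 h(1))
  show thesis
  proof (rule that[OF h(2) _ _ _ h(1)])
    show "Ck n h" for n using Ck_SucD[of n h] h(2) Hs[of n] by auto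
    show "Ck n (\<lambda>x. inverse (H x))" for n
      using Ck_exp[OF Ck_mult_left[OF Gs, of n "-1"]] by (simp add: H_def exp_minus)
    show "H x > 0" for x by (simp add: H_def)
    show "h (\<phi> x) = \<mu> * h x" if "x \<ge> 0" for x
      using h\<psi>[OF \<phi>pos[OF that]] \<psi>\<phi>[OF that] \<mu>(2) by (simp add: field_simps)
  qed
qed

section \<open>Eigenfunctions of the composition operator\<close>

text \<open>\<open>H\<close> is the derivative of \<open>h\<close>. The preimages under \<open>\<phi>\<close> within \<open>[0, y]\<close> express that \<open>\<phi>\<close> is onto and
  expanding.\<close>
locale linearized_expansion =
  fixes \<phi> h H :: "real \<Rightarrow> real" and \<mu> :: real
  assumes \<phi>_smooth: "\<And>n. Ck n \<phi>"
    and \<phi>_pos: "\<And>x. x \<ge> 0 \<Longrightarrow> \<phi> x \<ge> 0" and \<phi>_0: "\<phi> 0 = 0"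
    and \<phi>_preimage: "\<And>y. y \<ge> 0 \<Longrightarrow> \<exists>x\<in>{0..y}. \<phi> x = y"
    and \<mu>: "\<mu> > 1"
    and h_deriv: "halfline_deriv h H" and h_smooth: "\<And>n. Ck n h"
    and H_inverse_smooth: "\<And>n. Ck n (\<lambda>x. inverse (H x))" and H_pos: "\<And>x. H x > 0"
    and h_0: "h 0 = 0" and h_\<phi>: "\<And>x. x \<ge> 0 \<Longrightarrow> h (\<phi> x) = \<mu> * h x"
begin

text \<open>The function \<open>d = b' / H\<close> is the derivative of \<open>b\<close> in the coordinate \<open>h\<close>, in which \<open>\<phi>\<close> is
  multiplication by \<open>\<mu>\<close>; by the chain rule each differentiation divides the factor by \<open>\<mu>\<close>.\<close>
lemma normalized_derivative:
  fixes b r :: "real \<Rightarrow> complex" and c :: complex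
  assumes b: "\<And>n. Ck n b" and r: "halfline_deriv r r'"
    and eq: "\<And>x. x \<ge> 0 \<Longrightarrow> b (\<phi> x) = c * b x + r x"
  obtains d where "halfline_deriv b (\<lambda>x. H x *\<^sub>R d x)" "\<And>n. Ck n d"
    "\<And>x. x \<ge> 0 \<Longrightarrow> d (\<phi> x) = c / \<mu> * d x + r' x / (\<mu> * H x)"
proof -
  obtain b' where b': "halfline_deriv b b'" using b[of "Suc 0"] by auto
  obtain \<phi>' where \<phi>': "halfline_deriv \<phi> \<phi>'" using \<phi>_smooth[of "Suc 0"] by auto
  define d where "d x = inverse (H x) *\<^sub>R b' x" for x
  have b'd: "b' x = H x *\<^sub>R d x" for x using H_pos[of x] by (simp add: d_def)
  have "d (\<phi> x) = c / \<mu> * d x + r' x / (\<mu> * H x)" if x: "x \<ge> 0" for x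
  proof -
    have "halfline_deriv (\<lambda>x. \<mu> * h x) (\<lambda>x. \<phi>' x *\<^sub>R H (\<phi> x))"
      by (rule halfline_deriv_cong[OF halfline_deriv_compose[OF h_deriv \<phi>' \<phi>_pos]]) (auto simp: h_\<phi>)
    from halfline_deriv_unique[OF this halfline_deriv_mult_left[OF h_deriv] x]
    have H: "\<phi>' x * H (\<phi> x) = \<mu> * H x" by simp
    have "halfline_deriv (\<lambda>x. c * b x + r x) (\<lambda>x. \<phi>' x *\<^sub>R b' (\<phi> x))"
      by (rule halfline_deriv_cong[OF halfline_deriv_compose[OF b' \<phi>' \<phi>_pos]]) (auto simp: eq)
    from halfline_deriv_unique[OF this halfline_deriv_add[OF halfline_deriv_mult_left[OF b'] r] x]
    have "(\<phi>' x * H (\<phi> x)) *\<^sub>R d (\<phi> x) = c * (H x *\<^sub>R d x) + r' x" by (simp add: b'd)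
    then have "(\<mu> * H x) *\<^sub>R d (\<phi> x) = c * (H x *\<^sub>R d x) + r' x" by (simp only: H)
    then show ?thesis using \<mu> H_pos[of x] by (simp add: scaleR_conv_of_real field_simps)
  qed
  moreover have "Ck n d" for n
    unfolding d_def by (intro Ck_scaleR H_inverse_smooth Ck_all_derivative[OF b b'])
  moreover have "halfline_deriv b (\<lambda>x. H x *\<^sub>R d x)" using b' by (simp add: b'd[symmetric])
  ultimately show thesis using that by blast
qed

lemma h_power_deriv:
  "halfline_deriv (\<lambda>x. c * of_real (h x ^ Suc n) :: complex)
    (\<lambda>x. H x *\<^sub>R (of_nat (Suc n) * c * of_real (h x ^ n)))"
  unfolding halfline_deriv_def
proof (intro allI impI)
  fix x :: real assume "x \<ge> 0"
  then have "(h has_real_derivative H x) (at x within {0..})"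
    using h_deriv by (simp add: halfline_deriv_def has_real_derivative_iff_has_vector_derivative)
  then have "((\<lambda>x. h x ^ Suc n) has_real_derivative (H x * (Suc n * h x ^ n))) (at x within {0..})"
    by (rule DERIV_cong[OF DERIV_power_Suc]) simp
  then have "((\<lambda>x. complex_of_real (h x ^ Suc n)) has_vector_derivative of_real (H x * (Suc n * h x ^ n)))
      (at x within {0..})"
    unfolding has_real_derivative_iff_has_vector_derivative
    by (rule bounded_linear.has_vector_derivative[OF bounded_linear_of_real])
  then have "((\<lambda>x. c * complex_of_real (h x ^ Suc n)) has_vector_derivative
      c * of_real (H x * (Suc n * h x ^ n))) (at x within {0..})"
    by (rule has_vector_derivative_mult_right)
  moreover have "c * of_real (H x * (Suc n * h x ^ n)) = H x *\<^sub>R (of_nat (Suc n) * c * of_real (h x ^ n))"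
    by (simp add: scaleR_conv_of_real)
  ultimately show "((\<lambda>x. c * complex_of_real (h x ^ Suc n)) has_vector_derivative
      H x *\<^sub>R (of_nat (Suc n) * c * of_real (h x ^ n))) (at x within {0..})" by (simp only:)
qed

text \<open>If \<open>\<bar>b\<bar>\<close> attains its maximum over \<open>[0, X]\<close> at \<open>y = \<phi> x\<close>, then \<open>x\<close> also lies in that interval, so the
  maximum is at most \<open>\<bar>c\<bar>\<close> times itself.\<close>
lemma contracted_solution_zero:
  fixes b :: "real \<Rightarrow> complex"
  assumes b: "continuous_on {0..} b" and c: "norm c < 1"
    and eq: "\<And>x. x \<ge> 0 \<Longrightarrow> b (\<phi> x) = c * b x" and X: "X \<ge> 0"
  shows "b X = 0"
proof -
  have "\<exists>y\<in>{0..X}. \<forall>z\<in>{0..X}. norm (b z) \<le> norm (b y)"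
    by (rule continuous_attains_sup) (use X in \<open>auto intro!: continuous_intros continuous_on_subset[OF b]\<close>)
  then obtain y where y: "0 \<le> y" "y \<le> X" and max: "\<And>z. 0 \<le> z \<Longrightarrow> z \<le> X \<Longrightarrow> norm (b z) \<le> norm (b y)"
    by auto
  obtain x where x: "0 \<le> x" "x \<le> y" "\<phi> x = y" using \<phi>_preimage[OF y(1)] by auto
  have "norm (b y) = norm c * norm (b x)" using eq[OF x(1)] x(3) by (simp add: norm_mult)
  also have "\<dots> \<le> norm c * norm (b y)" using max[of x] x y by (intro mult_left_mono) auto
  finally have "(1 - norm c) * norm (b y) \<le> 0" by (simp add: algebra_simps)
  then have "norm (b y) = 0" using c by (simp add: mult_le_0_iff)
  then show ?thesis using max[of X] X by simp
qed

text \<open>Induction on \<open>k\<close>, the number of differentiations after which the factor is a contraction. The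
  normalized derivative is \<open>e h^n\<close> by the induction hypothesis, so \<open>b\<close> is \<open>b 0\<close> plus a multiple of
  \<open>h^(n+1)\<close>. The equation at \<open>0\<close> leaves a nonzero \<open>b 0\<close> only for \<open>c = 1\<close>, and then the power of
  \<open>h\<close> is absent, since \<open>\<mu>^(n+1) \<noteq> 1\<close>.\<close>
lemma eigenfunction_monomial:
  fixes b :: "real \<Rightarrow> complex"
  shows "norm c < \<mu> ^ k \<Longrightarrow> (\<And>n. Ck n b) \<Longrightarrow> (\<And>x. x \<ge> 0 \<Longrightarrow> b (\<phi> x) = c * b x) \<Longrightarrow>
    \<exists>e n. (\<forall>x\<ge>0. b x = e * of_real (h x ^ n)) \<and> (e = 0 \<or> c = of_real \<mu> ^ n)"
proof (induction k arbitrary: b c)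
  case 0
  have "b x = 0" if "x \<ge> 0" for x
    using contracted_solution_zero[OF Ck_continuous[OF 0(2)] _ 0(3) that] 0(1) by simp
  then show ?case by (intro exI[of _ 0]) simp
next
  case (Suc k)
  obtain d where d: "halfline_deriv b (\<lambda>x. H x *\<^sub>R d x)" "\<And>n. Ck n d"
    "\<And>x. x \<ge> 0 \<Longrightarrow> d (\<phi> x) = c / \<mu> * d x + 0 / (\<mu> * H x)"
    using normalized_derivative[OF Suc.prems(2) halfline_deriv_const[of 0], of c] Suc.prems(3)
    by auto
  have "norm (c / \<mu>) < \<mu> ^ k" using Suc.prems(1) \<mu> by (simp add: norm_divide field_simps)
  then obtain e n where e: "\<And>x. x \<ge> 0 \<Longrightarrow> d x = e * of_real (h x ^ n)" "e = 0 \<or> c / \<mu> = of_real \<mu> ^ n"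
    using Suc.IH[of "c / \<mu>" d] d(2,3) by auto
  have cn: "e = 0 \<or> c = of_real \<mu> ^ Suc n" using e(2) \<mu> by (auto simp: field_simps)
  \<comment> \<open>the coefficient of \<open>h^(n+1)\<close> in the antiderivative of \<open>e h^n h'\<close>\<close>
  define e' where "e' = e / of_nat (Suc n)"
  have e': "of_nat (Suc n) * e' = e" unfolding e'_def by (simp del: of_nat_Suc)
  have "halfline_deriv b (\<lambda>x. H x *\<^sub>R (of_nat (Suc n) * e' * of_real (h x ^ n)))"
    by (rule halfline_deriv_cong[OF d(1)]) (auto simp: e(1) e' simp del: of_nat_Suc)
  from halfline_deriv_diff[OF this h_power_deriv[of e' n]]
  have const: "halfline_deriv (\<lambda>x. b x - e' * of_real (h x ^ Suc n)) (\<lambda>x. 0)" by (simp only: diff_self)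
  have bx: "b x = b 0 + e' * of_real (h x ^ Suc n)" if "x \<ge> 0" for x
    using halfline_deriv_zero_const[OF const that] by (simp add: h_0 algebra_simps)
  show ?case
  proof (cases "b 0 = 0")
    case True
    then have "b x = e' * of_real (h x ^ Suc n)" if "x \<ge> 0" for x
      using bx[OF that] by (simp only: add_0_left)
    moreover have "e' = 0 \<or> c = of_real \<mu> ^ Suc n" using cn by (auto simp: e'_def)
    ultimately show ?thesis by blast
  next
    case False
    then have "c = 1" using Suc.prems(3)[of 0] \<phi>_0 by simp
    moreover have "of_real \<mu> ^ Suc n \<noteq> (1::complex)"
    proof -
      have "\<mu> ^ Suc n > 1" using \<mu> by (rule one_less_power) simp
      then show ?thesis by (metis less_irrefl of_real_1 of_real_eq_iff of_real_power)
    qed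
    ultimately have "e = 0" using cn by metis
    then have "b x = b 0 * of_real (h x ^ 0)" if "x \<ge> 0" for x
      using bx[OF that] by (simp add: e'_def)
    moreover have "c = of_real \<mu> ^ 0" using \<open>c = 1\<close> by simp
    ultimately show ?thesis by blast
  qed
qed

text \<open>Each normalized derivative lowers \<open>n\<close> by one and multiplies \<open>e\<close> by a nonzero constant. For
  \<open>n = 0\<close> the equation at the fixed point \<open>0\<close> reads \<open>g 0 = g 0 + e\<close>.\<close>
lemma resonance_obstruction:
  fixes g :: "real \<Rightarrow> complex"
  shows "(\<And>k. Ck k g) \<Longrightarrow>
    (\<And>x. x \<ge> 0 \<Longrightarrow> g (\<phi> x) = of_real \<mu> ^ n * g x + e * of_real (h x ^ n)) \<Longrightarrow> e = 0"
proof (induction n arbitrary: g e)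
  case 0
  then show ?case using \<phi>_0 0(2)[of 0] by simp
next
  case (Suc n)
  obtain d :: "real \<Rightarrow> complex" where d: "halfline_deriv g (\<lambda>x. H x *\<^sub>R d x)" "\<And>n. Ck n d"
    "\<And>x. x \<ge> 0 \<Longrightarrow> d (\<phi> x) = of_real \<mu> ^ Suc n / of_real \<mu> * d x
      + H x *\<^sub>R (of_nat (Suc n) * e * of_real (h x ^ n)) / (\<mu> * H x)"
    by (rule normalized_derivative[OF Suc.prems(1) h_power_deriv Suc.prems(2)]) (assumption, rule that)
  have "d (\<phi> x) = of_real \<mu> ^ n * d x + (of_nat (Suc n) * e / \<mu>) * of_real (h x ^ n)"
    if "x \<ge> 0" for x
    using d(3)[OF that] \<mu> H_pos[of x] by (simp add: scaleR_conv_of_real del: of_nat_Suc)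
  from Suc.IH[of d "of_nat (Suc n) * e / \<mu>", OF d(2) this]
  have "of_nat (Suc n) * e / \<mu> = 0" .
  then show ?case using \<mu> by (simp del: of_nat_Suc)
qed

definition monomial :: "nat \<Rightarrow> real \<Rightarrow> complex" where
  "monomial n x = (if x \<ge> 0 then of_real (h x ^ n) else 0)"

lemma monomial_in_K_space: "fun_scale e (monomial n) \<in> K_space \<phi> (of_real \<mu> ^ n)"
proof -
  have "Ck k (\<lambda>x. e * (h x ^ n *\<^sub>R 1))" for k
    by (rule Ck_mult_left[OF Ck_scaleR[OF Ck_power[OF h_smooth] Ck_const]])
  then have "Ck k (fun_scale e (monomial n))" for k
    by (rule Ck_cong) (simp add: fun_scale_def monomial_def scaleR_conv_of_real)
  then show ?thesis
    by (simp add: K_space_def Cinf_iff fun_scale_def monomial_def \<phi>_pos h_\<phi> power_mult_distrib)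
qed

lemma K_spaceD:
  assumes "b \<in> K_space \<phi> lam"
  obtains e n where "b = fun_scale e (monomial n)" "e = 0 \<or> lam = of_real \<mu> ^ n"
proof -
  obtain k where "norm lam < \<mu> ^ k" using real_arch_pow[OF \<mu>] by blast
  then obtain e n where "\<forall>x\<ge>0. b x = e * of_real (h x ^ n)" "e = 0 \<or> lam = of_real \<mu> ^ n"
    using eigenfunction_monomial[of lam k b] assms by (auto simp: K_space_def Cinf_iff)
  moreover have "b x = 0" if "x < 0" for x using assms that by (auto simp: K_space_def Cinf_iff)
  ultimately show thesis
    by (intro that[of e n]) (auto simp: fun_eq_iff fun_scale_def monomial_def)
qed

lemma zero_in_K_space: "0 \<in> K_space \<phi> lam"
  by (simp add: K_space_def Cinf_iff zero_fun_def Ck_const)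

lemma K_space_nonresonant:
  assumes "\<nexists>n. lam = of_real \<mu> ^ n"
  shows "K_space \<phi> lam = {0}"
proof -
  have "b = 0" if "b \<in> K_space \<phi> lam" for b
    using that assms by (elim K_spaceD) (auto simp: fun_scale_def fun_eq_iff)
  then show ?thesis using zero_in_K_space by blast
qed

lemma K_space_resonant: "K_space \<phi> (of_real \<mu> ^ n) = range (\<lambda>e. fun_scale e (monomial n))"
proof (intro equalityI subsetI)
  fix b assume "b \<in> K_space \<phi> (of_real \<mu> ^ n)"
  then obtain e m where b: "b = fun_scale e (monomial m)" and em: "e = 0 \<or> complex_of_real \<mu> ^ n = of_real \<mu> ^ m"
    by (rule K_spaceD)
  have "n = m" if "complex_of_real \<mu> ^ n = of_real \<mu> ^ m"
    using that \<mu> by (simp flip: of_real_power)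
  then have "b = fun_scale e (monomial n)" using em b by (auto simp: fun_scale_def)
  then show "b \<in> range (\<lambda>e. fun_scale e (monomial n))" by blast
qed (use monomial_in_K_space in auto)

lemma monomial_nonzero: "monomial n \<noteq> 0"
proof
  assume m: "monomial n = 0"
  have "h x = 0" if "x \<ge> 0" for x
    using fun_cong[OF m, of x] that by (simp add: monomial_def)
  then have "halfline_deriv h (\<lambda>x. 0)"
    by (intro halfline_deriv_cong[OF halfline_deriv_const[of 0]]) auto
  from halfline_deriv_unique[OF h_deriv this, of 0] H_pos[of 0] show False by simp
qed

end

text \<open>A preimage \<open>x\<close> of \<open>y\<close> lies below \<open>y\<close> because \<open>\<phi> x \<ge> x\<close>.\<close>
lemma expanding_diffeo_linearized:
  assumes \<phi>: "halfline_diffeo \<phi>" "expanding \<phi>"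
    and \<mu>: "(\<phi> has_real_derivative \<mu>) (at 0 within {0..})" "\<mu> > 1"
  obtains h H where "linearized_expansion \<phi> h H \<mu>"
proof -
  obtain h H where h: "halfline_deriv h H" "\<And>n. Ck n h" "\<And>n. Ck n (\<lambda>x. inverse (H x))"
    "\<And>x. H x > 0" "h 0 = 0" "\<And>x. x \<ge> 0 \<Longrightarrow> h (\<phi> x) = \<mu> * h x"
    using smooth_linearization[OF \<phi> \<mu>] by blast
  have bij: "bij_betw \<phi> {0..} {0..}" and \<phi>s: "\<And>n. Ck n \<phi>"
    using \<phi>(1) by (auto simp: halfline_diffeo_def smooth_on_halfline_iff)
  have pre: "\<exists>x\<in>{0..y}. \<phi> x = y" if "y \<ge> 0" for y
  proof -
    have "y \<in> \<phi> ` {0..}" using bij that by (auto simp: bij_betw_def)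
    then obtain x where x: "x \<ge> 0" "\<phi> x = y" by auto
    then have "x \<le> y" using \<phi>(2) by (cases "x = 0") (auto simp: expanding_def less_imp_le)
    with x show ?thesis by auto
  qed
  have "linearized_expansion \<phi> h H \<mu>"
    using bij \<phi>(2) by unfold_locales (auto simp: \<phi>s \<mu> h pre bij_betw_def expanding_def)
  then show thesis by (rule that)
qed

section \<open>The Jordan block\<close>

lemma jordan_entry_sum:
  assumes "i \<in> {1..M}"
  shows "(\<Sum>j=1..M. jordan_entry lam i j * b j x) = lam * b i x + (if i = 1 then 0 else b (i - 1) x)"
proof -
  have "(\<Sum>j=1..M. jordan_entry lam i j * b j x)
      = (\<Sum>j=1..M. (if i = j then lam * b j x else 0) + (if i - 1 = j then b j x else 0))"
    using assms by (intro sum.cong) (auto simp: jordan_entry_def)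
  then show ?thesis using assms by (auto simp: sum.distrib)
qed

text \<open>The components vanish one after the other, since a nonzero resonant \<open>b i\<close> would obstruct the
  equation of \<open>b (i + 1)\<close>. The last component escapes because no further equation contains it.\<close>
lemma (in linearized_expansion) vector_solution_iff:
  assumes b: "b \<in> Cinf_vec M" and M: "M \<ge> 1"
  shows "solves_vec_eq \<phi> lam M b \<longleftrightarrow> (\<forall>i\<in>{1..M-1}. b i = 0) \<and> b M \<in> K_space \<phi> lam"
proof
  assume sol: "solves_vec_eq \<phi> lam M b"
  have eq: "b i (\<phi> x) = lam * b i x + (if i = 1 then 0 else b (i - 1) x)" if "i \<in> {1..M}" "x \<ge> 0" for i x
    using sol that jordan_entry_sum[OF that(1), of lam b x] by (simp add: solves_vec_eq_def)
  have Cinf: "b i \<in> Cinf" if "i \<in> {1..M}" for i using b that by (auto simp: Cinf_vec_def)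
  have inK: "b i \<in> K_space \<phi> lam" if "i \<in> {1..M}" "i = 1 \<or> b (i - 1) = 0" for i
    using eq[OF that(1)] that Cinf[OF that(1)] by (auto simp: K_space_def)
  have vanish: "i \<in> {1..M-1} \<longrightarrow> b i = 0" for i
  proof (induction i)
    case (Suc i)
    show ?case
    proof
      assume i: "Suc i \<in> {1..M-1}"
      have "b (Suc i) \<in> K_space \<phi> lam" using Suc.IH i by (intro inK) auto
      then obtain e n where e: "b (Suc i) = fun_scale e (monomial n)" "e = 0 \<or> lam = of_real \<mu> ^ n"
        by (rule K_spaceD)
      have "e = 0" if lam: "lam = of_real \<mu> ^ n"
      proof (rule resonance_obstruction)
        show "Ck k (b (Suc (Suc i)))" for k using Cinf[of "Suc (Suc i)"] i by (auto simp: Cinf_iff)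
        show "b (Suc (Suc i)) (\<phi> x) = of_real \<mu> ^ n * b (Suc (Suc i)) x + e * of_real (h x ^ n)"
          if "x \<ge> 0" for x
          using eq[of "Suc (Suc i)" x] i that by (auto simp: e(1) fun_scale_def monomial_def lam)
      qed
      then show "b (Suc i) = 0" using e by (auto simp: fun_scale_def fun_eq_iff)
    qed
  qed simp
  have "b M \<in> K_space \<phi> lam" using vanish[of "M - 1"] M by (intro inK) auto
  with vanish show "(\<forall>i\<in>{1..M-1}. b i = 0) \<and> b M \<in> K_space \<phi> lam" by blast
next
  assume z: "(\<forall>i\<in>{1..M-1}. b i = 0) \<and> b M \<in> K_space \<phi> lam"
  show "solves_vec_eq \<phi> lam M b"
    unfolding solves_vec_eq_def
  proof (intro allI impI ballI)
    fix x :: real and i assume x: "x \<ge> 0" and i: "i \<in> {1..M}"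
    have "b (i - 1) x = 0" if "i \<noteq> 1"
    proof -
      have "i - 1 \<in> {1..M-1}" using i that by auto
      then have "b (i - 1) = 0" using z by blast
      then show ?thesis by simp
    qed
    moreover have "b i (\<phi> x) = lam * b i x"
      using z i x by (cases "i = M") (auto simp: K_space_def)
    ultimately show "b i (\<phi> x) = (\<Sum>j=1..M. jordan_entry lam i j * b j x)"
      using jordan_entry_sum[OF i, of lam b x] by simp
  qed
qed

lemma (in linearized_expansion) vec_solution_space_eq:
  assumes "M \<ge> 1"
  shows "vec_solution_space \<phi> lam M = (\<lambda>f i. if i = M then f else 0) ` K_space \<phi> lam"
proof (intro equalityI subsetI)
  fix b assume b: "b \<in> vec_solution_space \<phi> lam M"
  then have bM: "b \<in> Cinf_vec M" "\<forall>i\<in>{1..M-1}. b i = 0" "b M \<in> K_space \<phi> lam"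
    using vector_solution_iff[of b M lam] assms by (auto simp: vec_solution_space_def)
  have "b i = 0" if "i \<noteq> M" for i
    using bM(1,2) that by (cases "i \<in> {1..M}") (auto simp: Cinf_vec_def)
  then have "b = (\<lambda>i. if i = M then b M else 0)" by auto
  with bM(3) show "b \<in> (\<lambda>f i. if i = M then f else 0) ` K_space \<phi> lam" by blast
next
  fix b assume "b \<in> (\<lambda>f i. if i = M then f else 0) ` K_space \<phi> lam"
  then obtain f where f: "f \<in> K_space \<phi> lam" "b = (\<lambda>i. if i = M then f else 0)" by blast
  have "f \<in> Cinf" "0 \<in> Cinf" using f(1) zero_in_K_space by (auto simp: K_space_def)
  then have b: "b \<in> Cinf_vec M" using assms by (auto simp: Cinf_vec_def f(2))
  moreover have "solves_vec_eq \<phi> lam M b"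
    unfolding vector_solution_iff[OF b assms] using f by auto
  ultimately show "b \<in> vec_solution_space \<phi> lam M" by (simp add: vec_solution_space_def)
qed

lemma (in vector_space) line_subspace_dim:
  assumes "v \<noteq> 0" "S = range (\<lambda>k. scale k v)"
  shows "subspace S \<and> dim S = 1"
proof -
  have S: "S = span {v}" using assms(2) by (simp add: span_singleton)
  moreover have "dim S = card {v}"
    by (rule dim_eq_card) (use assms(1) in \<open>auto simp: S span_span\<close>)
  ultimately show ?thesis by (simp add: subspace_span)
qed

theorem theorem5p1:
  fixes \<phi> :: "real \<Rightarrow> real" and \<mu> :: real and lam :: complex and M :: nat
  assumes "halfline_diffeo \<phi>"
    and "expanding \<phi>"
    and "(\<phi> has_real_derivative \<mu>) (at 0 within {0..})"
    and "\<mu> > 1"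
    and "norm lam > 1"
    and "M \<ge> 2"
  shows "((\<exists>n::nat. n \<ge> 1 \<and> lam = complex_of_real \<mu> ^ n) \<longrightarrow>
            fun_space.subspace (K_space \<phi> lam) \<and> fun_space.dim (K_space \<phi> lam) = 1
          \<and> (\<forall>b \<in> Cinf_vec M. solves_vec_eq \<phi> lam M b \<longleftrightarrow>
                (\<forall>i\<in>{1..M-1}. b i = 0) \<and> b M \<in> K_space \<phi> lam)
          \<and> vec_fun_space.subspace (vec_solution_space \<phi> lam M)
          \<and> vec_fun_space.dim (vec_solution_space \<phi> lam M) = 1)
       \<and> ((\<nexists>n::nat. n \<ge> 1 \<and> lam = complex_of_real \<mu> ^ n) \<longrightarrow>
            K_space \<phi> lam = {0}
          \<and> vec_solution_space \<phi> lam M = {0})"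
proof -
  obtain h H where "linearized_expansion \<phi> h H \<mu>"
    by (rule expanding_diffeo_linearized[OF assms(1-4)])
  then interpret linearized_expansion \<phi> h H \<mu> .
  have M: "M \<ge> 1" using assms(6) by simp
  show ?thesis
  proof (intro conjI impI)
    assume "\<exists>n::nat. n \<ge> 1 \<and> lam = complex_of_real \<mu> ^ n"
    then obtain n where n: "lam = complex_of_real \<mu> ^ n" by blast
    have K: "K_space \<phi> lam = range (\<lambda>e. fun_scale e (monomial n))"
      unfolding n by (rule K_space_resonant)
    then show "fun_space.subspace (K_space \<phi> lam)" "fun_space.dim (K_space \<phi> lam) = 1"
      using fun_space.line_subspace_dim[OF monomial_nonzero] by blast+
    show "\<forall>b \<in> Cinf_vec M. solves_vec_eq \<phi> lam M b \<longleftrightarrow>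
        (\<forall>i\<in>{1..M-1}. b i = 0) \<and> b M \<in> K_space \<phi> lam"
      using vector_solution_iff M by blast
    let ?v = "\<lambda>i. if i = M then monomial n else 0"
    have "?v \<noteq> 0" using monomial_nonzero[of n] by (auto simp: fun_eq_iff)
    moreover have "vec_solution_space \<phi> lam M = range (\<lambda>e. vec_fun_scale e ?v)"
    proof -
      have "(\<lambda>i. if i = M then fun_scale e (monomial n) else 0) = vec_fun_scale e ?v" for e
        by (auto simp: fun_eq_iff vec_fun_scale_def fun_scale_def)
      then show ?thesis unfolding vec_solution_space_eq[OF M] K image_image by simp
    qed
    ultimately show "vec_fun_space.subspace (vec_solution_space \<phi> lam M)"
      "vec_fun_space.dim (vec_solution_space \<phi> lam M) = 1"
      using vec_fun_space.line_subspace_dim by blast+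
  next
    assume nr: "\<nexists>n::nat. n \<ge> 1 \<and> lam = complex_of_real \<mu> ^ n"
    have "lam \<noteq> of_real \<mu> ^ n" for n
      using nr assms(5) by (cases n) auto
    then show K: "K_space \<phi> lam = {0}" by (intro K_space_nonresonant) blast
    then show "vec_solution_space \<phi> lam M = {0}"
      unfolding vec_solution_space_eq[OF M] by (auto simp: fun_eq_iff)
  qed
qed

end
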